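(* Every finite simple graph $G$ on $n$ vertices without isolated vertices satisfies \[ f_{\mathrm{o}}(G)\ge \frac{n}{5}. \]
   Context: All graphs are finite and simple. A graph is called odd if every one of its vertices has odd degree in it (the graph with no vertices is vacuously odd). For $X\subseteq V(G)$, $G[X]$ denotes the subgraph of $G$ induced by $X$. For a graph $G$, define $f_{\mathrm{o}}(G):=\max\{|S| : S\subseteq V(G)\text{ and }G[S]\text{ is odd}\}$. An isolated vertex is a vertex of degree $0$. *)

theory Defs
  imports Complex_Main "Graph_Theory.Digraph_Component"
begin

text \<open>
  A finite simple graph is an instance of the locale \<open>graph\<close> of \<open>Graph_Theory\<close>: a finite
  symmetric digraph without loops and parallel arcs, in which an undirected edge \<open>uv\<close> is the
  pair of arcs \<open>u \<rightarrow> v\<close> and \<open>v \<rightarrow> u\<close>. The number of edges at a vertex is therefore the number of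
  arcs leaving it.
\<close>

abbreviation degree :: "('a, 'b) pre_digraph \<Rightarrow> 'a \<Rightarrow> nat" where
  "degree G v \<equiv> out_degree G v"

definition isolated_vertex :: "('a, 'b) pre_digraph \<Rightarrow> 'a \<Rightarrow> bool" where
  "isolated_vertex G v \<longleftrightarrow> v \<in> verts G \<and> degree G v = 0"

definition odd_graph :: "('a, 'b) pre_digraph \<Rightarrow> bool" where
  "odd_graph G \<longleftrightarrow> (\<forall>v \<in> verts G. odd (degree G v))"

definition f_o :: "('a, 'b) pre_digraph \<Rightarrow> nat" where
  "f_o G = Max {card S | S. S \<subseteq> verts G \<and> odd_graph (G \<restriction> S)}"

text \<open>The maximum is taken over a finite set that contains \<open>0\<close>, so it is a genuine maximum.\<close>

lemma f_o_set:
  assumes "finite (verts G)"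
  shows "finite {card S | S. S \<subseteq> verts G \<and> odd_graph (G \<restriction> S)}"
    and "0 \<in> {card S | S. S \<subseteq> verts G \<and> odd_graph (G \<restriction> S)}"
proof -
  have "{card S | S. S \<subseteq> verts G \<and> odd_graph (G \<restriction> S)} \<subseteq> card ` Pow (verts G)"
    by blast
  then show "finite {card S | S. S \<subseteq> verts G \<and> odd_graph (G \<restriction> S)}"
    using assms finite_subset by blast
  have "odd_graph (G \<restriction> {})"
    by (simp add: odd_graph_def)
  then show "0 \<in> {card S | S. S \<subseteq> verts G \<and> odd_graph (G \<restriction> S)}"
    by force
qed

end

theory Submission
  imports Defs "HOL-Library.Z2"
begin

text \<open>
  Throughout, a simple graph on a finite vertex set is a symmetric irreflexive relation \<open>E\<close>.

  The bound rests on a reduction that loses a factor of two: if all degrees of the bipartite graph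
  \<^emph>\<open>between\<close> two disjoint sets \<open>X\<close> and \<open>Y\<close> are odd, then, whatever the edges inside \<open>X\<close> and inside
  \<open>Y\<close> are, the set \<open>X \<union> Y\<close> splits into two parts that both induce odd graphs, and the larger one has
  at least \<open>card (X \<union> Y) / 2\<close> vertices (\<open>odd_between_imp_large_odd_on\<close>). This is linear algebra
  modulo two. Gallai's theorem, that every graph splits into two parts inducing even graphs,
  follows from the fact that the diagonal of a symmetric matrix lies in its column space, applied
  to the Laplacian. Shifting Gallai's partition by the partition into \<open>X\<close> and \<open>Y\<close> flips the parity
  of every degree.

  It remains to find large bipartite graphs with all degrees odd. Since no vertex is isolated,
  there is a dominating set \<open>D\<close> in which every \<open>d\<close> has a private neighbour \<open>p d\<close>, that is, a vertex
  of the complement \<open>A\<close> whose only neighbour in \<open>D\<close> is \<open>d\<close>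
  (\<open>exists_dominating_set_with_private_neighbours\<close>). There are two candidates.

  \<^item> Between \<open>D\<close> and \<open>p ` D\<close> the graph is a perfect matching on \<open>2 * card D\<close> vertices, so some odd
    induced subgraph has at least \<open>card D\<close> vertices.

  \<^item> For a suitable \<open>C \<subseteq> D\<close>, at least half of \<open>A\<close> has an odd number of neighbours in \<open>C\<close>; this half
    contains the private neighbours of the vertices of \<open>C\<close>. Deleting from it the private
    neighbours of those vertices of \<open>C\<close> that have even degree makes all degrees in between odd,
    and the vertices of \<open>C\<close> make up for the deleted ones (\<open>exists_large_odd_between\<close>). So some odd
    induced subgraph has at least \<open>card A / 4\<close> vertices.

  As \<open>n = card D + card A\<close>, an odd induced subgraph of maximum size \<open>f\<close> satisfies
  \<open>n \<le> f + 4 * f = 5 * f\<close>.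
\<close>

section \<open>Linear algebra over the field with two elements\<close>

(* These rules unfold the field operations into a boolean case distinction, which would prevent
   the ring laws from applying. *)
declare add_bit_eq_xor [simp del] mult_bit_eq_and [simp del]

text \<open>
  If the diagonal vanishes, the zero vector works. Otherwise pivot on some \<open>v\<close> with \<open>M v v = 1\<close>:
  the Schur complement \<open>N\<close> is again symmetric, and its diagonal is \<open>M u u + M u v\<close> because squaring
  is the identity modulo two. This is the diagonal of \<open>M\<close> with the column of \<open>v\<close> added, so a solution
  for \<open>N\<close> extends to one for \<open>M\<close>.
\<close>

lemma symmetric_diagonal_in_column_space:
  fixes M :: "'a \<Rightarrow> 'a \<Rightarrow> bit"
  assumes "finite V"
    and "\<And>u w. u \<in> V \<Longrightarrow> w \<in> V \<Longrightarrow> M u w = M w u"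
  shows "\<exists>x. \<forall>u\<in>V. (\<Sum>w\<in>V. M u w * x w) = M u u"
  using assms
proof (induction V arbitrary: M rule: finite_psubset_induct)
  case (psubset V)
  show ?case
  proof (cases "\<forall>u\<in>V. M u u = 0")
    case True
    then show ?thesis
      by (intro exI[of _ "\<lambda>_. 0"]) simp
  next
    case False
    then obtain v where v: "v \<in> V" "M v v = 1"
      by auto
    define V' where "V' = V - {v}"
    define N where "N u w = M u w + M u v * M v w" for u w
    have V': "V' \<subset> V" "finite V'" "v \<notin> V'" "V = insert v V'"
      using v psubset.hyps by (auto simp: V'_def)
    have "N u w = N w u" if "u \<in> V'" "w \<in> V'" for u w
      using psubset.prems[of u w] psubset.prems[of u v] psubset.prems[of v w] that V' v
      by (simp add: N_def mult.commute)
    then obtain x where x: "\<And>u. u \<in> V' \<Longrightarrow> (\<Sum>w\<in>V'. N u w * x w) = N u u"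
      using psubset.IH[OF V'(1), of N] by blast
    define s where "s = (\<Sum>w\<in>V'. M v w * x w)"
    \<comment> \<open>The entry at \<open>v\<close> is forced by row \<open>v\<close>, whose right-hand side is \<open>M v v = 1\<close>.\<close>
    define y where "y = x(v := 1 + s)"
    have split_v: "(\<Sum>w\<in>V. M u w * y w) = M u v * (1 + s) + (\<Sum>w\<in>V'. M u w * x w)" for u
    proof -
      have "(\<Sum>w\<in>V'. M u w * y w) = (\<Sum>w\<in>V'. M u w * x w)"
        using V'(3) by (intro sum.cong) (auto simp: y_def)
      then show ?thesis
        using V' by (simp add: y_def)
    qed
    have "(\<Sum>w\<in>V. M u w * y w) = M u u" if "u \<in> V" for u
    proof (cases "u = v")
      case True
      then show ?thesis
        using v split_v[of v] by (cases s) (simp_all flip: s_def)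
    next
      case False
      with that have u: "u \<in> V'"
        by (simp add: V'_def)
      have "(\<Sum>w\<in>V'. N u w * x w) = (\<Sum>w\<in>V'. M u w * x w + M u v * (M v w * x w))"
        by (intro sum.cong refl) (simp only: N_def distrib_right mult.assoc)
      also have "\<dots> = (\<Sum>w\<in>V'. M u w * x w) + M u v * s"
        by (simp only: sum.distrib s_def sum_distrib_left)
      finally have "(\<Sum>w\<in>V'. M u w * x w) + M u v * s = M u u + M u v * M v u"
        using x[OF u] by (simp only: N_def)
      moreover have "M v u = M u v"
        using psubset.prems[of u v] that v by simp
      ultimately show ?thesis
        unfolding split_v[of u]
        by (cases s; cases "M u v"; cases "M u u"; cases "\<Sum>w\<in>V'. M u w * x w") simp_all
    qed
    then show ?thesis
      by blast
  qed
qed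

section \<open>From odd bipartite subgraphs to odd subgraphs\<close>

definition odd_on :: "('a \<Rightarrow> 'a \<Rightarrow> bool) \<Rightarrow> 'a set \<Rightarrow> bool" where
  "odd_on E S \<longleftrightarrow> (\<forall>v\<in>S. odd (card {u \<in> S. E v u}))"

definition odd_between :: "('a \<Rightarrow> 'a \<Rightarrow> bool) \<Rightarrow> 'a set \<Rightarrow> 'a set \<Rightarrow> bool" where
  "odd_between E X Y \<longleftrightarrow>
    (\<forall>v\<in>X. odd (card {u \<in> Y. E v u})) \<and> (\<forall>v\<in>Y. odd (card {u \<in> X. E v u}))"

lemma sum_of_bool_bit:
  assumes "finite S"
  shows "(\<Sum>u\<in>S. of_bool (P u) :: bit) = of_bool (odd (card {u \<in> S. P u}))"
  using assms
proof (induction S rule: finite_induct)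
  case (insert a S)
  have "{u \<in> insert a S. P u} = (if P a then insert a {u \<in> S. P u} else {u \<in> S. P u})"
    by auto
  with insert show ?case
    by (auto)
qed simp

text \<open>
  Encode a partition of \<open>T = X \<union> Y\<close> by a vector \<open>z\<close> of bits, and let \<open>L\<close> be the Laplacian of the graph
  on \<open>T\<close> modulo two. Then \<open>L z\<close> lists, modulo two, the number of neighbours that each vertex has
  in the opposite part. The diagonal of \<open>L\<close> is the degree vector \<open>d\<close>, so some \<open>x\<close> has \<open>L x = d\<close>:
  every vertex has as many neighbours across as in total, hence an even number in its own part,
  which is Gallai's theorem. The indicator \<open>y\<close> of \<open>X\<close> satisfies \<open>L y = 1\<close> by assumption. So
  \<open>L (x + y) = d + 1\<close>, which means that in the partition given by \<open>x + y\<close> every vertex has an odd number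
  of neighbours in its own part.
\<close>

lemma odd_between_imp_large_odd_on:
  assumes fin: "finite X" "finite Y" and disj: "X \<inter> Y = {}"
    and sym: "\<And>u v. E u v \<Longrightarrow> E v u" and irrefl: "\<And>v. \<not> E v v"
    and odd: "odd_between E X Y"
  shows "\<exists>S \<subseteq> X \<union> Y. odd_on E S \<and> card (X \<union> Y) \<le> 2 * card S"
proof -
  define T where "T = X \<union> Y"
  have T: "finite T"
    using fin by (simp add: T_def)
  define A :: "'a \<Rightarrow> 'a \<Rightarrow> bit" where "A u w = of_bool (E u w)" for u w
  define d where "d u = (\<Sum>w\<in>T. A u w)" for u
  define L where "L u w = (if u = w then d u else A u w)" for u w
  have A_sym: "A u w = A w u" for u w
    using sym by (auto simp: A_def)
  have L_apply: "(\<Sum>w\<in>T. L u w * x w) = (\<Sum>w\<in>T. A u w * (x u + x w))"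
    if "u \<in> T" for u and x :: "'a \<Rightarrow> bit"
  proof -
    have "(\<Sum>w\<in>T - {u}. L u w * x w) = (\<Sum>w\<in>T - {u}. A u w * x w)"
      by (intro sum.cong refl) (auto simp: L_def)
    then have "(\<Sum>w\<in>T. L u w * x w) = d u * x u + (\<Sum>w\<in>T - {u}. A u w * x w)"
      using sum.remove[OF T that, of "\<lambda>w. L u w * x w"] by (simp add: L_def)
    also have "(\<Sum>w\<in>T - {u}. A u w * x w) = (\<Sum>w\<in>T. A u w * x w)"
      using sum.remove[OF T that, of "\<lambda>w. A u w * x w"] irrefl[of u] by (simp add: A_def)
    finally show ?thesis
      by (simp only: d_def sum_distrib_right sum.distrib distrib_left)
  qed
  obtain x where x: "\<And>u. u \<in> T \<Longrightarrow> (\<Sum>w\<in>T. A u w * (x u + x w)) = d u"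
    using symmetric_diagonal_in_column_space[OF T, of L] A_sym L_apply
    by (metis L_def)
  define y :: "'a \<Rightarrow> bit" where "y u = of_bool (u \<in> X)" for u
  have y: "(\<Sum>w\<in>T. A u w * (y u + y w)) = 1" if "u \<in> T" for u
  proof -
    have "(\<Sum>w\<in>T. A u w * (y u + y w)) = (\<Sum>w\<in>T. of_bool (E u w \<and> (u \<in> X) \<noteq> (w \<in> X)))"
      by (intro sum.cong refl) (auto simp: A_def y_def)
    also have "\<dots> = of_bool (odd (card {w \<in> T. E u w \<and> (u \<in> X) \<noteq> (w \<in> X)}))"
      by (rule sum_of_bool_bit[OF T])
    also have "{w \<in> T. E u w \<and> (u \<in> X) \<noteq> (w \<in> X)} = {w \<in> (if u \<in> X then Y else X). E u w}"
      using disj that by (auto simp: T_def)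
    also have "of_bool (odd (card \<dots>)) = (1 :: bit)"
      using odd that by (auto simp: odd_between_def T_def)
    finally show ?thesis .
  qed
  define S where "S b = {u \<in> T. x u + y u = b}" for b
  have "odd_on E (S b)" for b
    unfolding odd_on_def
  proof
    fix u assume u: "u \<in> S b"
    then have uT: "u \<in> T"
      by (simp add: S_def)
    \<comment> \<open>The bit \<open>1 + (x u + y u) + (x w + y w)\<close> is one exactly if \<open>u\<close> and \<open>w\<close> are in the same part.\<close>
    have "(\<Sum>w\<in>T. of_bool (E u w \<and> w \<in> S b)) = (\<Sum>w\<in>T. A u w + (A u w * (x u + x w) + A u w * (y u + y w)))"
    proof (intro sum.cong refl)
      fix w assume "w \<in> T"
      with u show "of_bool (E u w \<and> w \<in> S b) = A u w + (A u w * (x u + x w) + A u w * (y u + y w))"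
        by (cases "x u"; cases "x w"; cases "y u"; cases "y w"; cases b) (auto simp: A_def S_def)
    qed
    also have "\<dots> = d u + (d u + 1)"
      using x[OF uT] y[OF uT] by (simp only: sum.distrib d_def[symmetric])
    also have "\<dots> = 1"
      by (cases "d u") auto
    finally have "odd (card {w \<in> T. E u w \<and> w \<in> S b})"
      by (simp add: sum_of_bool_bit[OF T] del: sum_of_bool_eq)
    moreover have "{w \<in> T. E u w \<and> w \<in> S b} = {w \<in> S b. E u w}"
      by (auto simp: S_def)
    ultimately show "odd (card {w \<in> S b. E u w})"
      by simp
  qed
  moreover have "S b \<subseteq> X \<union> Y" for b
    by (auto simp: S_def T_def)
  moreover have "card (X \<union> Y) \<le> 2 * card (S 0) \<or> card (X \<union> Y) \<le> 2 * card (S 1)"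
  proof -
    have "X \<union> Y = S 0 \<union> S 1"
      by (auto simp: S_def T_def)
    then have "card (X \<union> Y) \<le> card (S 0) + card (S 1)"
      by (simp add: card_Un_le)
    then show ?thesis
      by linarith
  qed
  ultimately show ?thesis
    by metis
qed

section \<open>Dominating sets with private neighbours\<close>

text \<open>
  This is a theorem of Bollobas and Cockayne. Among the dominating sets of minimum size, take one
  with as many vertices as possible that have a neighbour inside the set. Suppose that \<open>d\<close> has no
  private neighbour outside. If \<open>d\<close> had a neighbour in \<open>D\<close>, it could be dropped. So \<open>d\<close> is isolated in
  \<open>D\<close>, and it can be exchanged for a neighbour \<open>w\<close> outside. But \<open>w\<close>, not being private to \<open>d\<close>, is
  adjacent to another vertex of \<open>D\<close>, so the exchange increases the quantity that was maximal.
\<close>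

lemma exists_dominating_set_with_private_neighbours:
  assumes fin: "finite V"
    and sym: "\<And>u v. E u v \<Longrightarrow> E v u" and irrefl: "\<And>v. \<not> E v v"
    and no_isolated: "\<And>v. v \<in> V \<Longrightarrow> \<exists>u\<in>V. E v u"
  shows "\<exists>D p. D \<subseteq> V \<and> (\<forall>a\<in>V - D. \<exists>d\<in>D. E a d) \<and>
    (\<forall>d\<in>D. p d \<in> V - D \<and> {c \<in> D. E (p d) c} = {d})"
proof -
  define dom where "dom D \<longleftrightarrow> D \<subseteq> V \<and> (\<forall>a\<in>V - D. \<exists>d\<in>D. E a d)" for D
  define m where "m D = card {v \<in> D. \<exists>u\<in>D. E v u}" for D
  have "dom V"
    by (simp add: dom_def)
  then obtain D0 where D0: "dom D0" "\<And>D. dom D \<Longrightarrow> card D0 \<le> card D"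
    using ex_has_least_nat[of dom V card] by blast
  have "m D \<le> card V" if "dom D" for D
    unfolding m_def using that fin by (intro card_mono) (auto simp: dom_def)
  then obtain D where D: "dom D" "card D = card D0"
      and D_max: "\<And>D'. dom D' \<Longrightarrow> card D' = card D0 \<Longrightarrow> m D' \<le> m D"
    using ex_has_greatest_nat[of "\<lambda>D. dom D \<and> card D = card D0" D0 m "Suc (card V)"] D0(1)
    by (metis less_Suc_eq_le)
  have DV: "D \<subseteq> V" and D_fin: "finite D" and D_dom: "\<And>a. a \<in> V - D \<Longrightarrow> \<exists>d\<in>D. E a d"
    using D(1) fin by (auto simp: dom_def intro: finite_subset)
  have "\<exists>a\<in>V - D. {c \<in> D. E a c} = {d}" if d: "d \<in> D" for d
  proof (rule ccontr)
    assume no_private: "\<not> ?thesis"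
    have others: "\<exists>c\<in>D - {d}. E a c" if "a \<in> V - D" for a
      using D_dom[OF that] no_private that d by blast
    have isolated: "\<not> E d c" if c: "c \<in> D" for c
    proof
      assume "E d c"
      then have "c \<in> D - {d}"
        using c irrefl by auto
      with others \<open>E d c\<close> have "dom (D - {d})"
        using DV unfolding dom_def by blast
      then have "card D \<le> card (D - {d})"
        using D0(2) D(2) by metis
      moreover have "card (D - {d}) < card D"
        using D_fin d by (rule card_Diff1_less)
      ultimately show False
        by simp
    qed
    obtain w where w: "w \<in> V - D" "E d w"
      using no_isolated[of d] d DV isolated by blast
    obtain c where c: "c \<in> D - {d}" "E w c"
      using others[OF w(1)] by blast
    define D' where "D' = insert w (D - {d})"
    have "dom D'"
      using others w sym[OF w(2)] sym DV unfolding dom_def D'_def by blast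
    moreover have "card D' = card D0"
      using card_Suc_Diff1[OF D_fin d] D_fin w(1) D(2) by (simp add: D'_def del: card_Diff_insert)
    ultimately have "m D' \<le> m D"
      by (rule D_max)
    moreover have "m D < m D'"
      unfolding m_def
    proof (rule psubset_card_mono)
      show "finite {v \<in> D'. \<exists>u\<in>D'. E v u}"
        using D_fin by (simp add: D'_def)
      have "w \<in> {v \<in> D'. \<exists>u\<in>D'. E v u}"
        using c by (auto simp: D'_def)
      moreover have "{v \<in> D. \<exists>u\<in>D. E v u} \<subseteq> {v \<in> D'. \<exists>u\<in>D'. E v u}"
        using isolated sym unfolding D'_def by blast
      ultimately show "{v \<in> D. \<exists>u\<in>D. E v u} \<subset> {v \<in> D'. \<exists>u\<in>D'. E v u}"
        using w(1) by blast
    qed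
    ultimately show False
      by simp
  qed
  then obtain p where "\<forall>d\<in>D. p d \<in> V - D \<and> {c \<in> D. E (p d) c} = {d}"
    by metis
  with DV D_dom show ?thesis
    by blast
qed

section \<open>Large odd bipartite subgraphs\<close>

text \<open>
  Decide for the vertices of \<open>D\<close> one after another whether they belong to \<open>C\<close>. The parity at a vertex
  of \<open>A\<close> is settled when its last neighbour in \<open>D\<close> is decided, and of the vertices settled by the same
  decision, one of the two choices makes at least half odd.
\<close>

lemma exists_subset_with_odd_degree_from_half:
  assumes "finite D" "finite A" "\<And>a. a \<in> A \<Longrightarrow> \<exists>d\<in>D. E a d"
  shows "\<exists>C\<subseteq>D. card A \<le> 2 * card {a \<in> A. odd (card {c \<in> C. E a c})}"
  using assms
proof (induction D arbitrary: A rule: finite_induct)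
  case empty
  then have "A = {}"
    by auto
  then show ?case
    by simp
next
  case (insert d D)
  \<comment> \<open>Here \<open>d\<close> is decided last: it settles \<open>A1\<close>, while \<open>A2\<close> is settled by the decisions in \<open>D\<close>.\<close>
  define A1 where "A1 = {a \<in> A. E a d}"
  define A2 where "A2 = {a \<in> A. \<not> E a d}"
  have fin: "finite A1" "finite A2"
    using insert.prems(1) by (auto simp: A1_def A2_def)
  have "\<exists>c\<in>D. E a c" if "a \<in> A2" for a
    using insert.prems(2)[of a] that by (auto simp: A2_def)
  from insert.IH[OF fin(2) this]
  obtain C where C: "C \<subseteq> D" and C_A2: "card A2 \<le> 2 * card {a \<in> A2. odd (card {c \<in> C. E a c})}"
    by blast
  have C_fin: "finite C" and d_notin: "d \<notin> C"
    using C insert.hyps by (auto intro: finite_subset)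
  define O1 where "O1 = {a \<in> A1. odd (card {c \<in> C. E a c})}"
  define O2 where "O2 = {a \<in> A2. odd (card {c \<in> C. E a c})}"
  have flip: "card {c \<in> insert d C. E a c} = (if E a d then Suc else id) (card {c \<in> C. E a c})" for a
  proof -
    have "{c \<in> insert d C. E a c} = (if E a d then insert d {c \<in> C. E a c} else {c \<in> C. E a c})"
      by auto
    then show ?thesis
      using C_fin d_notin by simp
  qed
  have without_d: "{a \<in> A. odd (card {c \<in> C. E a c})} = O1 \<union> O2"
    by (auto simp: O1_def O2_def A1_def A2_def)
  have with_d: "{a \<in> A. odd (card {c \<in> insert d C. E a c})} = (A1 - O1) \<union> O2"
    unfolding flip O1_def O2_def A1_def A2_def by auto
  have O_fin: "finite O1" "finite O2" "O1 \<subseteq> A1" "O2 \<subseteq> A2"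
    using fin by (auto simp: O1_def O2_def)
  have disj: "A1 \<inter> A2 = {}" "A = A1 \<union> A2"
    by (auto simp: A1_def A2_def)
  have "card A = card A1 + card A2"
    using disj fin by (simp add: card_Un_disjoint)
  moreover have "card (O1 \<union> O2) = card O1 + card O2"
    using disj O_fin by (intro card_Un_disjoint) auto
  moreover have "card ((A1 - O1) \<union> O2) = (card A1 - card O1) + card O2"
    using disj O_fin fin by (subst card_Un_disjoint) (auto simp: card_Diff_subset)
  moreover have "card O1 \<le> card A1"
    using O_fin fin by (simp add: card_mono)
  moreover have "card A2 \<le> 2 * card O2"
    using C_A2 by (simp add: O2_def)
  ultimately have "card A \<le> 2 * card (O1 \<union> O2) \<or> card A \<le> 2 * card ((A1 - O1) \<union> O2)"
    by linarith
  then show ?case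
    using C unfolding without_d[symmetric] with_d[symmetric] by blast
qed

text \<open>
  Private neighbours allow the degree of each vertex of \<open>C\<close> to be corrected on its own: deleting
  \<open>p c\<close> changes the degree of \<open>c\<close> and of no other vertex of \<open>C\<close>. At most \<open>card C\<close> vertices of \<open>A\<close> are
  deleted, and \<open>C\<close> itself is gained.
\<close>

lemma exists_large_odd_between:
  assumes fin: "finite D" "finite A" and disj: "D \<inter> A = {}"
    and sym: "\<And>u v. E u v \<Longrightarrow> E v u"
    and dom: "\<And>a. a \<in> A \<Longrightarrow> \<exists>d\<in>D. E a d"
    and p_in: "\<And>d. d \<in> D \<Longrightarrow> p d \<in> A"
    and p_private: "\<And>d. d \<in> D \<Longrightarrow> {c \<in> D. E (p d) c} = {d}"
  shows "\<exists>C W. C \<subseteq> D \<and> W \<subseteq> A \<and> odd_between E C W \<and> card A \<le> 2 * card (C \<union> W)"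
proof -
  obtain C where C: "C \<subseteq> D" and half: "card A \<le> 2 * card {a \<in> A. odd (card {c \<in> C. E a c})}"
    using exists_subset_with_odd_degree_from_half[of D A E, OF fin dom] by blast
  define B where "B = {a \<in> A. odd (card {c \<in> C. E a c})}"
  define Q where "Q = {c \<in> C. even (card {b \<in> B. E c b})}"
  define W where "W = B - p ` Q"
  have C_fin: "finite C" and B_fin: "finite B" and Q_fin: "finite Q"
    using C fin by (auto simp: B_def Q_def intro: finite_subset)
  have p_adj: "c \<in> D \<Longrightarrow> d \<in> D \<Longrightarrow> E c (p d) \<longleftrightarrow> c = d" for c d
    using p_private[of d] sym by blast
  have p_B: "p c \<in> B" if c: "c \<in> C" for c
  proof -
    have "{c' \<in> C. E (p c) c'} = {c}"
      using p_private[of c] c C by blast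
    then show ?thesis
      using p_in c C by (auto simp: B_def)
  qed
  have "odd (card {b \<in> W. E c b})" if c: "c \<in> C" for c
  proof (cases "c \<in> Q")
    case True
    have "E c (p q) \<longleftrightarrow> q = c" if "q \<in> Q" for q
      using that c C p_adj[of c q] by (auto simp: Q_def)
    then have "{b \<in> W. E c b} = {b \<in> B. E c b} - {p c}"
      using True by (auto simp: W_def)
    moreover have "p c \<in> {b \<in> B. E c b}"
      using p_B[OF c] p_adj c C by auto
    moreover have "finite {b \<in> B. E c b}"
      using B_fin by simp
    ultimately have "Suc (card {b \<in> W. E c b}) = card {b \<in> B. E c b}"
      using card.remove by metis
    moreover have "even (card {b \<in> B. E c b})"
      using True by (simp add: Q_def)
    ultimately show ?thesis
      by (metis even_Suc)
  next
    case False
    have "\<not> E c (p q)" if "q \<in> Q" for q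
      using that False c C p_adj[of c q] by (auto simp: Q_def)
    then have "{b \<in> W. E c b} = {b \<in> B. E c b}"
      by (auto simp: W_def)
    then show ?thesis
      using False c by (simp add: Q_def)
  qed
  then have "odd_between E C W"
    by (auto simp: odd_between_def W_def B_def)
  moreover have "card B \<le> card (C \<union> W)"
  proof -
    have "card B = card (p ` Q) + card W"
    proof -
      have "p ` Q \<subseteq> B"
        using p_B by (auto simp: Q_def)
      then show ?thesis
        using B_fin Q_fin by (simp add: W_def card_Diff_subset card_mono)
    qed
    moreover have "card (p ` Q) \<le> card Q"
      using Q_fin by (rule card_image_le)
    moreover have "card Q \<le> card C"
      using C_fin by (intro card_mono) (auto simp: Q_def)
    moreover have "card (C \<union> W) = card C + card W"
      using C_fin B_fin disj C by (intro card_Un_disjoint) (auto simp: W_def B_def)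
    ultimately show ?thesis
      by linarith
  qed
  moreover have "W \<subseteq> A"
    by (auto simp: W_def B_def)
  ultimately show ?thesis
    using C half[folded B_def] by (meson le_trans mult_le_mono2)
qed

lemma exists_odd_on_fifth:
  assumes fin: "finite V"
    and sym: "\<And>u v. E u v \<Longrightarrow> E v u" and irrefl: "\<And>v. \<not> E v v"
    and no_isolated: "\<And>v. v \<in> V \<Longrightarrow> \<exists>u\<in>V. E v u"
  shows "\<exists>S\<subseteq>V. odd_on E S \<and> card V \<le> 5 * card S"
proof -
  obtain D p where D: "D \<subseteq> V" and dom: "\<And>a. a \<in> V - D \<Longrightarrow> \<exists>d\<in>D. E a d"
      and p_in: "\<And>d. d \<in> D \<Longrightarrow> p d \<in> V - D"
      and p_private: "\<And>d. d \<in> D \<Longrightarrow> {c \<in> D. E (p d) c} = {d}"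
    using exists_dominating_set_with_private_neighbours[of V E, OF fin sym irrefl no_isolated]
    by blast
  define A where "A = V - D"
  have fin': "finite D" "finite A" "D \<inter> A = {}" and V: "V = D \<union> A"
    using D fin by (auto simp: A_def intro: finite_subset)
  have p_adj: "c \<in> D \<Longrightarrow> d \<in> D \<Longrightarrow> E c (p d) \<longleftrightarrow> c = d" for c d
    using p_private[of d] sym by blast
  obtain S1 where S1: "S1 \<subseteq> V" "odd_on E S1" "card D \<le> card S1"
  proof -
    have "{u \<in> p ` D. E d u} = {p d}" if "d \<in> D" for d
      using that p_adj by auto
    then have "odd_between E D (p ` D)"
      using p_private by (auto simp: odd_between_def)
    moreover have "D \<inter> p ` D = {}"
      using p_in by auto
    ultimately obtain S where S: "S \<subseteq> D \<union> p ` D" "odd_on E S" "card (D \<union> p ` D) \<le> 2 * card S"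
      using odd_between_imp_large_odd_on[of D "p ` D" E] fin' sym irrefl by auto
    have "inj_on p D"
      using p_adj by (metis inj_onI)
    then have "card (D \<union> p ` D) = 2 * card D"
      using fin' \<open>D \<inter> p ` D = {}\<close> by (simp add: card_Un_disjoint card_image)
    then show thesis
      using that[of S] S D p_in by auto
  qed
  obtain S2 where S2: "S2 \<subseteq> V" "odd_on E S2" "card A \<le> 4 * card S2"
  proof -
    obtain C W where CW: "C \<subseteq> D" "W \<subseteq> A" "odd_between E C W" "card A \<le> 2 * card (C \<union> W)"
      using exists_large_odd_between[of D A E p, OF fin' sym dom[folded A_def]
          p_in[folded A_def] p_private]
      by blast
    have "finite C" "finite W" "C \<inter> W = {}"
      using CW fin' by (auto intro: finite_subset)
    then obtain S where "S \<subseteq> C \<union> W" "odd_on E S" "card (C \<union> W) \<le> 2 * card S"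
      using odd_between_imp_large_odd_on[of C W E] sym irrefl CW by auto
    then show thesis
      using that[of S] CW V by auto
  qed
  have "card V = card D + card A"
    unfolding V using fin' by (rule card_Un_disjoint)
  then have "card V \<le> 5 * card S1 \<or> card V \<le> 5 * card S2"
    using S1 S2 by linarith
  then show ?thesis
    using S1 S2 by blast
qed

section \<open>Odd induced subgraphs of simple graphs\<close>

text \<open>
  Without parallel arcs, an arc leaving \<open>v\<close> is determined by its head.
\<close>

lemma (in graph) degree_induce_subgraph:
  assumes "v \<in> S"
  shows "degree (G \<restriction> S) v = card {u \<in> S. v \<rightarrow>\<^bsub>G\<^esub> u}"
proof -
  have "bij_betw (head G) (out_arcs (G \<restriction> S) v) {u \<in> S. v \<rightarrow>\<^bsub>G\<^esub> u}"
  proof (rule bij_betw_imageI)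
    show "inj_on (head G) (out_arcs (G \<restriction> S) v)"
      by (auto simp: inj_on_def out_arcs_def induce_subgraph_def arc_to_ends_def
          intro!: no_multi_arcs)
    show "head G ` out_arcs (G \<restriction> S) v = {u \<in> S. v \<rightarrow>\<^bsub>G\<^esub> u}"
      using assms by (auto simp: out_arcs_def induce_subgraph_def arcs_ends_conv)
  qed
  then show ?thesis
    by (simp add: out_degree_def bij_betw_same_card)
qed

lemma (in graph) odd_graph_induce_subgraph_iff:
  "odd_graph (G \<restriction> S) \<longleftrightarrow> odd_on (\<lambda>u v. u \<rightarrow>\<^bsub>G\<^esub> v) S"
  by (auto simp: odd_graph_def odd_on_def degree_induce_subgraph)

theorem theorem1p4:
  fixes G :: "('a, 'b) pre_digraph" and n :: nat
  assumes "graph G"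
    and "card (verts G) = n"
    and "\<not> (\<exists>v. isolated_vertex G v)"
  shows "real (f_o G) \<ge> real n / 5"
proof -
  interpret graph G
    by (rule assms(1))
  have "\<exists>u\<in>verts G. v \<rightarrow>\<^bsub>G\<^esub> u" if "v \<in> verts G" for v
  proof -
    have "out_arcs G v \<noteq> {}"
      using assms(3) that by (auto simp: isolated_vertex_def out_degree_def)
    then show ?thesis
      by (auto simp: out_arcs_def arcs_ends_conv)
  qed
  moreover have "\<not> v \<rightarrow>\<^bsub>G\<^esub> v" for v
    using adj_not_same by blast
  moreover have "v \<rightarrow>\<^bsub>G\<^esub> u" if "u \<rightarrow>\<^bsub>G\<^esub> v" for u v
    using sym_arcs that by (rule arcs_ends_symmetric)
  ultimately obtain S where S: "S \<subseteq> verts G" "odd_on (\<lambda>u v. u \<rightarrow>\<^bsub>G\<^esub> v) S" "n \<le> 5 * card S"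
    using exists_odd_on_fifth[of "verts G" "\<lambda>u v. u \<rightarrow>\<^bsub>G\<^esub> v"] assms(2) by auto
  then have "card S \<le> f_o G"
    unfolding f_o_def
    by (intro Max_ge f_o_set) (auto simp: odd_graph_induce_subgraph_iff)
  with S(3) have "n \<le> 5 * f_o G"
    by linarith
  then show ?thesis
    by linarith
qed

end
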